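(* Let $\Sigma$ be a finite alphabet and let $\mathbb{D}$ be a totally-ordered value domain whose order topology is metrizable. A property $\varPhi : \Sigma^\omega \to \mathbb{D}$ is safe and co-safe if and only if it is discounting.
   Context: $\Sigma^*$ and $\Sigma^\omega$ are the sets of finite and infinite words over the finite nonempty alphabet $\Sigma$, and $\Sigma^n$ is the set of words of length $n$; $u \prec w$ means that the finite word $u$ is a strict prefix of $w$ (the empty word is allowed). A value domain $\mathbb{D}$ is a complete lattice with $\bot \neq \top$. A property is a total function $\varPhi : \Sigma^\omega \to \mathbb{D}$. $\varPhi$ is safe when for every $w \in \Sigma^\omega$ and $v \in \mathbb{D}$ with $\varPhi(w) \not\geq v$, there is $u \prec w$ such that $\sup_{w' \in \Sigma^\omega} \varPhi(uw') \not\geq v$. $\varPhi$ is co-safe when for every $w \in \Sigma^\omega$ and $v \in \mathbb{D}$ with $\varPhi(w) \not\leq v$, there is $u \prec w$ such that $\inf_{w' \in \Sigma^\omega} \varPhi(uw') \not\leq v$. The order topology on a totally-ordered $\mathbb{D}$ is generated by the sets $\{v' \in \mathbb{D} : v' < v\}$ and $\{v' \in \mathbb{D} : v < v'\}$ for $v \in \mathbb{D}$. Let $d$ be a metric on $\mathbb{D}$ inducing the order topology. $\varPhi$ is discounting (with respect to $d$) when for every $\varepsilon > 0$ there exists $n \in \mathbb{N}$ such that for every $u \in \Sigma^n$ and all $w, w' \in \Sigma^\omega$ we have $d(\varPhi(uw), \varPhi(uw')) < \varepsilon$. *)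

theory Defs
  imports "HOL-Analysis.Analysis" "HOL-Library.Omega_Words_Fun"
begin

(* Infinite words are elements of 'a word = nat => 'a, finite words are lists, and
   u \<frown> w is concatenation. A finite word is always a strict prefix of an infinite one. *)
definition strict_prefix_of :: "'a list \<Rightarrow> 'a word \<Rightarrow> bool"  (infix \<open>\<prec>\<^sub>\<omega>\<close> 50)
  where "u \<prec>\<^sub>\<omega> w \<longleftrightarrow> (\<exists>w'. w = u \<frown> w')"

definition safe :: "('a word \<Rightarrow> 'd::complete_lattice) \<Rightarrow> bool"
  where "safe \<Phi> \<longleftrightarrow>
    (\<forall>w v. \<not> \<Phi> w \<ge> v \<longrightarrow> (\<exists>u. u \<prec>\<^sub>\<omega> w \<and> \<not> (SUP w'. \<Phi> (u \<frown> w')) \<ge> v))"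

definition co_safe :: "('a word \<Rightarrow> 'd::complete_lattice) \<Rightarrow> bool"
  where "co_safe \<Phi> \<longleftrightarrow>
    (\<forall>w v. \<not> \<Phi> w \<le> v \<longrightarrow> (\<exists>u. u \<prec>\<^sub>\<omega> w \<and> \<not> (INF w'. \<Phi> (u \<frown> w')) \<le> v))"

(* The open rays cover UNIV, so that the topspace is UNIV, as soon as the order has at least
   two elements; for a one-element order the generated topology would be empty. *)
definition ray_topology :: "'d::linorder topology"
  where "ray_topology = topology_generated_by (range lessThan \<union> range greaterThan)"

definition induces_order_topology :: "('d::linorder \<Rightarrow> 'd \<Rightarrow> real) \<Rightarrow> bool"
  where "induces_order_topology d \<longleftrightarrow>
    Metric_space UNIV d \<and> Metric_space.mtopology UNIV d = ray_topology"

definition discounting :: "('d \<Rightarrow> 'd \<Rightarrow> real) \<Rightarrow> ('a word \<Rightarrow> 'd) \<Rightarrow> bool"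
  where "discounting d \<Phi> \<longleftrightarrow>
    (\<forall>\<epsilon>>0. \<exists>n. \<forall>u. length u = n \<longrightarrow> (\<forall>w w'. d (\<Phi> (u \<frown> w)) (\<Phi> (u \<frown> w')) < \<epsilon>))"

end

theory Submission
  imports Defs
begin

text \<open>
  For a totally ordered \<open>\<bbbD>\<close>, safety together with co-safety is continuity of \<open>\<Phi>\<close> from the prefix
  topology on infinite words to the order topology, and discounting is uniform continuity.
  As the alphabet is finite, the space of infinite words is compact, so that the two coincide.
\<close>

lemma strict_prefix_of_iff: "u \<prec>\<^sub>\<omega> w \<longleftrightarrow> (\<exists>n. u = prefix n w)"
proof
  assume "u \<prec>\<^sub>\<omega> w"
  then obtain w' where "w = u \<frown> w'"
    unfolding strict_prefix_of_def by blast
  then have "u = prefix (length u) w"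
    by simp
  then show "\<exists>n. u = prefix n w" ..
next
  assume "\<exists>n. u = prefix n w"
  then show "u \<prec>\<^sub>\<omega> w"
    unfolding strict_prefix_of_def using prefix_suffix by blast
qed

lemma safe_iff:
  fixes \<Phi> :: "'a word \<Rightarrow> 'd::complete_linorder"
  shows "safe \<Phi> \<longleftrightarrow> (\<forall>w v. \<Phi> w < v \<longrightarrow> (\<exists>n. (SUP w'. \<Phi> (prefix n w \<frown> w')) < v))"
  unfolding safe_def strict_prefix_of_iff not_le by blast

lemma co_safe_iff:
  fixes \<Phi> :: "'a word \<Rightarrow> 'd::complete_linorder"
  shows "co_safe \<Phi> \<longleftrightarrow> (\<forall>w v. v < \<Phi> w \<longrightarrow> (\<exists>n. v < (INF w'. \<Phi> (prefix n w \<frown> w'))))"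
  unfolding co_safe_def strict_prefix_of_iff not_le by blast

text \<open>Continuity at each \<open>w\<close> for the topology whose basic neighbourhoods of
  \<open>w\<close> are the cylinders of words sharing a prefix with \<open>w\<close>; stated
  directly, so no topology on words has to be set up.\<close>

definition prefix_continuous :: "'d topology \<Rightarrow> ('a word \<Rightarrow> 'd) \<Rightarrow> bool"
  where "prefix_continuous T \<Phi> \<longleftrightarrow>
    (\<forall>w V. openin T V \<and> \<Phi> w \<in> V \<longrightarrow> (\<exists>n. \<forall>w'. \<Phi> (prefix n w \<frown> w') \<in> V))"

lemma prefix_conc_add:
  fixes m n :: nat and w w' :: "'a word"
  shows "\<exists>w''. prefix (m + n) w \<frown> w' = prefix m w \<frown> w''"
  unfolding subsequence_append conc_conc[symmetric] by blast

text \<open>A subbasis suffices: the sets \<open>V\<close> that satisfy the condition at a fixed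
  \<open>w\<close> are closed under binary intersections and arbitrary unions.\<close>

lemma prefix_continuous_generated:
  assumes "\<And>w V. V \<in> S \<Longrightarrow> \<Phi> w \<in> V \<Longrightarrow> \<exists>n. \<forall>w'. \<Phi> (prefix n w \<frown> w') \<in> V"
  shows "prefix_continuous (topology_generated_by S) \<Phi>"
  unfolding prefix_continuous_def
proof (intro allI impI)
  fix w V
  assume "openin (topology_generated_by S) V \<and> \<Phi> w \<in> V"
  then have "generate_topology_on S V" "\<Phi> w \<in> V"
    by (simp_all add: openin_topology_generated_by_iff)
  then show "\<exists>n. \<forall>w'. \<Phi> (prefix n w \<frown> w') \<in> V"
  proof (induction V rule: generate_topology_on.induct)
    case (Int A B)
    then obtain m n where m: "\<forall>w'. \<Phi> (prefix m w \<frown> w') \<in> A" and n: "\<forall>w'. \<Phi> (prefix n w \<frown> w') \<in> B"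
      by auto
    \<comment> \<open>The length \<open>m + n\<close> serves as a common bound: such a prefix
      extends both given ones, so its cylinder lies in both of theirs.\<close>
    have "\<forall>w'. \<Phi> (prefix (m + n) w \<frown> w') \<in> A \<inter> B"
    proof
      fix w'
      obtain x y where "prefix (m + n) w \<frown> w' = prefix m w \<frown> x"
        and "prefix (m + n) w \<frown> w' = prefix n w \<frown> y"
        using prefix_conc_add[where m = m and n = n and w = w and w' = w']
          prefix_conc_add[where m = n and n = m and w = w and w' = w']
        by (auto simp: add.commute)
      then show "\<Phi> (prefix (m + n) w \<frown> w') \<in> A \<inter> B"
        using m n by (metis IntI)
    qed
    then show ?case ..
  next
    case (UN K)
    then obtain k where "k \<in> K" "\<Phi> w \<in> k"
      by blast
    with UN.IH[of k] show ?case
      by blast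
  qed (use assms in auto)
qed

text \<open>Safety matches the rays \<open>{..<v}\<close> and co-safety the rays
  \<open>{v<..}\<close>, which together generate the topology.\<close>

lemma safe_and_co_safe_iff_prefix_continuous:
  fixes \<Phi> :: "'a word \<Rightarrow> 'd::complete_linorder"
  shows "safe \<Phi> \<and> co_safe \<Phi> \<longleftrightarrow> prefix_continuous ray_topology \<Phi>"
proof
  assume *: "safe \<Phi> \<and> co_safe \<Phi>"
  show "prefix_continuous ray_topology \<Phi>"
    unfolding ray_topology_def
  proof (rule prefix_continuous_generated)
    fix w V
    assume "V \<in> range lessThan \<union> range greaterThan" "\<Phi> w \<in> V"
    then consider v where "V = {..<v}" "\<Phi> w < v" | v where "V = {v<..}" "v < \<Phi> w"
      by auto
    then show "\<exists>n. \<forall>w'. \<Phi> (prefix n w \<frown> w') \<in> V"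
    proof cases
      case 1
      then obtain n where "(SUP w'. \<Phi> (prefix n w \<frown> w')) < v"
        using * unfolding safe_iff by blast
      with 1 show ?thesis
        by (auto dest: SUP_lessD)
    next
      case 2
      then obtain n where "v < (INF w'. \<Phi> (prefix n w \<frown> w'))"
        using * unfolding co_safe_iff by blast
      with 2 show ?thesis
        by (auto dest: less_INF_D)
    qed
  qed
next
  assume cont: "prefix_continuous ray_topology \<Phi>"
  have below: "\<exists>n. \<forall>w'. \<Phi> (prefix n w \<frown> w') < v" if "\<Phi> w < v" for w v
  proof -
    have "openin ray_topology {..<v}"
      unfolding ray_topology_def by (intro topology_generated_by_Basis) auto
    with cont that show ?thesis
      unfolding prefix_continuous_def by fastforce
  qed
  have above: "\<exists>n. \<forall>w'. v < \<Phi> (prefix n w \<frown> w')" if "v < \<Phi> w" for w v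
  proof -
    have "openin ray_topology {v<..}"
      unfolding ray_topology_def by (intro topology_generated_by_Basis) auto
    with cont that show ?thesis
      unfolding prefix_continuous_def by fastforce
  qed
  \<comment> \<open>A supremum of values below \<open>v\<close> may equal \<open>v\<close>. It does not if the values are bounded by some \<open>v'\<close>
    strictly between \<open>\<Phi> w\<close> and \<open>v\<close>, and if there is no such \<open>v'\<close>, then they are bounded by \<open>\<Phi> w\<close>.\<close>
  have "\<exists>n. (SUP w'. \<Phi> (prefix n w \<frown> w')) < v" if v: "\<Phi> w < v" for w v
  proof (cases "\<exists>v'. \<Phi> w < v' \<and> v' < v")
    case True
    then obtain v' n where "v' < v" "\<forall>w'. \<Phi> (prefix n w \<frown> w') < v'"
      using below by blast
    then show ?thesis
      by (meson SUP_least le_less_trans less_imp_le)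
  next
    case False
    with below[OF v] obtain n where "\<forall>w'. \<Phi> (prefix n w \<frown> w') \<le> \<Phi> w"
      by (meson not_le)
    with v show ?thesis
      by (meson SUP_least le_less_trans)
  qed
  moreover have "\<exists>n. v < (INF w'. \<Phi> (prefix n w \<frown> w'))" if v: "v < \<Phi> w" for w v
  proof (cases "\<exists>v'. v < v' \<and> v' < \<Phi> w")
    case True
    then obtain v' n where "v < v'" "\<forall>w'. v' < \<Phi> (prefix n w \<frown> w')"
      using above by blast
    then show ?thesis
      by (meson INF_greatest less_le_trans less_imp_le)
  next
    case False
    with above[OF v] obtain n where "\<forall>w'. \<Phi> w \<le> \<Phi> (prefix n w \<frown> w')"
      by (meson not_le)
    with v show ?thesis
      by (meson INF_greatest less_le_trans)
  qed
  ultimately show "safe \<Phi> \<and> co_safe \<Phi>"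
    unfolding safe_iff co_safe_iff by blast
qed

text \<open>Compactness of the word space in the form of Koenig's lemma: without a uniform length,
  the finite alphabet yields an infinite word that never meets \<open>G\<close>.\<close>

lemma uniform_bar:
  fixes G :: "'a::finite list \<Rightarrow> bool"
  assumes mono: "\<And>u v. G u \<Longrightarrow> G (u @ v)"
    and bar: "\<And>w. \<exists>n. G (prefix n w)"
  shows "\<exists>n. \<forall>u. length u = n \<longrightarrow> G u"
proof (rule ccontr)
  \<comment> \<open>\<open>T u\<close> is the uniform bound relative to the subtree at
    \<open>u\<close>. By \<open>step\<close>, a word failing \<open>T\<close> has a one-letter
    extension failing \<open>T\<close>.\<close>
  define T where "T u \<longleftrightarrow> (\<exists>n. \<forall>v. length v = n \<longrightarrow> G (u @ v))" for u
  have step: "T u" if "\<And>a. T (u @ [a])" for u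
  proof -
    from that obtain f where f: "\<And>a v. length v = f a \<Longrightarrow> G (u @ [a] @ v)"
      unfolding T_def by (metis append_assoc)
    \<comment> \<open>The maximum exists since the alphabet is finite; \<open>Suc\<close> accounts
      for the first letter \<open>a\<close>, and \<open>mono\<close> absorbs the letters of
      \<open>v'\<close> beyond the first \<open>f a\<close>.\<close>
    have "G (u @ v)" if v: "length v = Suc (Max (range f))" for v
    proof -
      obtain a v' where av: "v = a # v'" "length v' = Max (range f)"
        using v by (cases v) auto
      have "f a \<le> length v'"
        using av by simp
      then have "G ((u @ [a] @ take (f a) v') @ drop (f a) v')"
        by (intro mono f) simp
      then show ?thesis
        using av by simp
    qed
    then show ?thesis
      unfolding T_def by blast
  qed
  assume "\<nexists>n. \<forall>u. length u = n \<longrightarrow> G u"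
  then have "\<not> T []"
    unfolding T_def by simp
  \<comment> \<open>The infinite branch \<open>w\<close> is built by repeatedly choosing a letter
    that preserves the failure of \<open>T\<close>; \<open>p n\<close> is its prefix of length
    \<open>n\<close>.\<close>
  define next_letter where "next_letter u = (SOME a. \<not> T (u @ [a]))" for u
  define p where "p n = ((\<lambda>u. u @ [next_letter u]) ^^ n) []" for n
  define w where "w n = next_letter (p n)" for n
  have "p n = prefix n w" for n
    by (induction n) (simp_all add: p_def w_def subsequence_def)
  moreover have "\<not> T (p n)" for n
  proof (induction n)
    case 0
    with \<open>\<not> T []\<close> show ?case
      by (simp add: p_def)
  next
    case (Suc n)
    then have "\<exists>a. \<not> T (p n @ [a])"
      using step by blast
    then have "\<not> T (p n @ [next_letter (p n)])"
      unfolding next_letter_def by (rule someI_ex)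
    then show ?case
      by (simp add: p_def)
  qed
  moreover obtain n where "G (prefix n w)"
    using bar by blast
  then have "T (prefix n w)"
    \<comment> \<open>Length 0 leaves only the empty extension.\<close>
    unfolding T_def by (intro exI[of _ 0]) simp
  ultimately show False
    by simp
qed

lemma prefix_continuous_iff_discounting:
  fixes \<Phi> :: "'a::finite word \<Rightarrow> 'd"
  assumes "Metric_space UNIV d"
  shows "prefix_continuous (Metric_space.mtopology UNIV d) \<Phi> \<longleftrightarrow> discounting d \<Phi>"
proof -
  interpret Metric_space UNIV d
    by fact
  show ?thesis
  proof
    assume cont: "prefix_continuous mtopology \<Phi>"
    show "discounting d \<Phi>"
      unfolding discounting_def
    proof (intro allI impI)
      fix \<epsilon> :: real
      assume "\<epsilon> > 0"
      show "\<exists>n. \<forall>u. length u = n \<longrightarrow> (\<forall>w w'. d (\<Phi> (u \<frown> w)) (\<Phi> (u \<frown> w')) < \<epsilon>)"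
      \<comment> \<open>Here \<open>G u\<close> bounds the oscillation of \<open>\<Phi>\<close> on
        the cylinder of \<open>u\<close>. The bar is shown by continuity with radius
        \<open>\<epsilon>/2\<close>, as two values are compared through \<open>\<Phi> w\<close>;
        \<open>mono\<close> holds because longer prefixes have smaller cylinders.\<close>
      proof (rule uniform_bar)
        fix w
        have "openin mtopology (mball (\<Phi> w) (\<epsilon>/2))" "\<Phi> w \<in> mball (\<Phi> w) (\<epsilon>/2)"
          using \<open>\<epsilon> > 0\<close> by auto
        with cont obtain n where n: "\<And>w'. \<Phi> (prefix n w \<frown> w') \<in> mball (\<Phi> w) (\<epsilon>/2)"
          unfolding prefix_continuous_def by blast
        have "d (\<Phi> (prefix n w \<frown> x)) (\<Phi> (prefix n w \<frown> y)) < \<epsilon>" for x y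
          using n[of x] n[of y] triangle''[of "\<Phi> (prefix n w \<frown> x)" "\<Phi> w" "\<Phi> (prefix n w \<frown> y)"]
          by simp
        then show "\<exists>n. \<forall>x y. d (\<Phi> (prefix n w \<frown> x)) (\<Phi> (prefix n w \<frown> y)) < \<epsilon>"
          by blast
      qed (metis conc_conc)
    qed
  next
    assume disc: "discounting d \<Phi>"
    show "prefix_continuous mtopology \<Phi>"
      unfolding prefix_continuous_def
    proof (intro allI impI)
      fix w V
      assume "openin mtopology V \<and> \<Phi> w \<in> V"
      then obtain r where r: "r > 0" "mball (\<Phi> w) r \<subseteq> V"
        unfolding openin_mtopology by blast
      then obtain n where n: "\<And>u x y. length u = n \<Longrightarrow> d (\<Phi> (u \<frown> x)) (\<Phi> (u \<frown> y)) < r"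
        using disc unfolding discounting_def by blast
      \<comment> \<open>Splitting \<open>w\<close> at \<open>n\<close> puts \<open>w\<close> itself
        into the cylinder of \<open>prefix n w\<close>.\<close>
      have "d (\<Phi> w) (\<Phi> (prefix n w \<frown> w')) < r" for w'
        using n[of "prefix n w" "suffix n w" w'] by simp
      then show "\<exists>n. \<forall>w'. \<Phi> (prefix n w \<frown> w') \<in> V"
        using r by (intro exI[of _ n]) auto
    qed
  qed
qed

text \<open>Since \<open>mtopology\<close> of \<open>d\<close> equals \<open>ray_topology\<close>,
  both equivalences concern the same notion of continuity and can be chained.\<close>

theorem corollary3p27:
  fixes \<Phi> :: "'a::finite word \<Rightarrow> 'd::complete_linorder"
    and d :: "'d \<Rightarrow> 'd \<Rightarrow> real"
  assumes "(bot :: 'd) \<noteq> top"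
    and "induces_order_topology d"
  shows "safe \<Phi> \<and> co_safe \<Phi> \<longleftrightarrow> discounting d \<Phi>"
  using assms(2) safe_and_co_safe_iff_prefix_continuous[of \<Phi>] prefix_continuous_iff_discounting[of d \<Phi>]
  unfolding induces_order_topology_def by simp

end
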